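(* Let $Q$ be a power-associative CC-loop. Then for all $b,c\in Q$, the subloops $\langle b,c^6\rangle$ and $\langle b^2,c^3\rangle$ are groups.
   Context: A loop is a set $Q$ with a binary operation having a two-sided identity $1$ such that all equations $xu=y$ and $vx=y$ have unique solutions $u,v$. A loop $Q$ is conjugacy closed (a CC-loop) if there are functions $f,g:Q\times Q\to Q$ such that for all $x,y,z\in Q$: $x(yz)=f(x,y)(xz)$ and $(zy)x=(zx)g(x,y)$. $\langle S\rangle$ denotes the subloop generated by $S$. A loop is power-associative if for each $x$ the subloop $\langle x\rangle$ is a group. *)

theory Defs
  imports "HOL-Algebra.Group"
begin

text \<open>
  Loops are rendered on the \<open>monoid\<close> record of HOL-Algebra (carrier, multiplication,
  unit), without associativity.
\<close>

locale loop =
  fixes Q :: "('a, 'm) monoid_scheme" (structure)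
  assumes mult_closed: "\<lbrakk>x \<in> carrier Q; y \<in> carrier Q\<rbrakk> \<Longrightarrow> x \<otimes> y \<in> carrier Q"
    and one_closed: "\<one> \<in> carrier Q"
    and l_one: "x \<in> carrier Q \<Longrightarrow> \<one> \<otimes> x = x"
    and r_one: "x \<in> carrier Q \<Longrightarrow> x \<otimes> \<one> = x"
    and left_division: "\<lbrakk>x \<in> carrier Q; y \<in> carrier Q\<rbrakk> \<Longrightarrow> \<exists>!u. u \<in> carrier Q \<and> x \<otimes> u = y"
    and right_division: "\<lbrakk>x \<in> carrier Q; y \<in> carrier Q\<rbrakk> \<Longrightarrow> \<exists>!v. v \<in> carrier Q \<and> v \<otimes> x = y"

locale cc_loop = loop +
  assumes conjugacy_closed:
    "\<exists>f g. f \<in> carrier Q \<rightarrow> carrier Q \<rightarrow> carrier Q \<and> g \<in> carrier Q \<rightarrow> carrier Q \<rightarrow> carrier Q \<and>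
      (\<forall>x\<in>carrier Q. \<forall>y\<in>carrier Q. \<forall>z\<in>carrier Q.
        x \<otimes> (y \<otimes> z) = f x y \<otimes> (x \<otimes> z) \<and>
        (z \<otimes> y) \<otimes> x = (z \<otimes> x) \<otimes> g x y)"

text \<open>
  Solvability of both kinds of equations is required inside \<open>H\<close>, so a subloop is closed under
  both divisions.
\<close>

definition subloop :: "'a set \<Rightarrow> ('a, 'm) monoid_scheme \<Rightarrow> bool" where
  "subloop H Q \<longleftrightarrow> H \<subseteq> carrier Q \<and> loop (Q\<lparr>carrier := H\<rparr>)"

definition subloop_generated :: "('a, 'm) monoid_scheme \<Rightarrow> 'a set \<Rightarrow> ('a, 'm) monoid_scheme" where
  "subloop_generated Q S = Q\<lparr>carrier := \<Inter>{H. subloop H Q \<and> S \<subseteq> H}\<rparr>"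

locale power_associative_loop = loop +
  assumes power_associative: "x \<in> carrier Q \<Longrightarrow> group (subloop_generated Q {x})"

text \<open>
  Powers are the library's \<open>x [^] n\<close>, which is defined by recursion on the record alone
  (\<open>x [^] 0 = \<one>\<close> and \<open>x [^] Suc n = (x [^] n) \<otimes> x\<close>) and so makes sense without associativity; under
  power-associativity the bracketing is immaterial.
\<close>

end

theory Submission
  imports Defs
begin

text \<open>
  Write \<open>N\<close> for the nucleus. By Basarab's theorem \<open>Q/N\<close> is an abelian group, so every associator
  \<open>a(x,y,z)\<close>, given by \<open>x(yz) = ((xy)z) a(x,y,z)\<close>, lies in \<open>N\<close>. The left inner map
  \<open>z \<mapsto> z a(x,y,z)\<close> is an automorphism fixing \<open>N\<close> pointwise; hence the associators are central in
  \<open>N\<close>, depend only on classes modulo \<open>N\<close>, and satisfy \<open>a(x,y,zw) = a(x,y,z)\<^sup>w a(x,y,w)\<close>, where \<open>Q\<close>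
  acts on the centre of \<open>N\<close> by conjugation. The two conjugacy laws make \<open>a\<close> symmetric in its three
  arguments. A subloop generated by a set \<open>S\<close> is therefore a group as soon as \<open>a\<close> is trivial on \<open>S\<close>.

  Power-associativity gives \<open>a(u,u,u) = 1\<close>. With \<open>P = a(x,x,y)\<close> and \<open>R = a(x,y,y)\<close>, expanding this for
  \<open>u = xy\<close> yields \<open>P\<^sup>3 R\<^sup>3 = 1\<close>, and replacing \<open>y\<close> by \<open>y\<^sup>2\<close> then gives \<open>P\<^sup>6 = 1\<close> and \<open>P\<^sup>3 = R\<^sup>3\<close>.
  Moreover \<open>a(x,x,y\<^sup>3) = a(x,y,y\<^sup>3) = P\<^sup>3\<close>, which \<open>x\<close> and \<open>y\<close> fix, so a sixth power of \<open>y\<close>, or a square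
  of \<open>x\<close> together with a cube of \<open>y\<close>, kills all associators of the generators.
\<close>

section \<open>Divisions and cancellation in a loop\<close>

context loop
begin

definition ldiv :: "'a \<Rightarrow> 'a \<Rightarrow> 'a"
  where "ldiv x y = (THE u. u \<in> carrier Q \<and> x \<otimes> u = y)"

lemma ldiv_closed [simp]: "\<lbrakk>x \<in> carrier Q; y \<in> carrier Q\<rbrakk> \<Longrightarrow> ldiv x y \<in> carrier Q"
  and mult_ldiv [simp]: "\<lbrakk>x \<in> carrier Q; y \<in> carrier Q\<rbrakk> \<Longrightarrow> x \<otimes> ldiv x y = y"
  using theI'[OF left_division, of x y] unfolding ldiv_def by blast+

lemma l_cancel_iff:
  "\<lbrakk>x \<in> carrier Q; y \<in> carrier Q; z \<in> carrier Q\<rbrakk> \<Longrightarrow> x \<otimes> y = x \<otimes> z \<longleftrightarrow> y = z"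
  by (metis left_division mult_closed)

lemma r_cancel_iff:
  "\<lbrakk>x \<in> carrier Q; y \<in> carrier Q; z \<in> carrier Q\<rbrakk> \<Longrightarrow> y \<otimes> x = z \<otimes> x \<longleftrightarrow> y = z"
  by (metis right_division mult_closed)

lemma ldiv_eqI: "\<lbrakk>x \<in> carrier Q; u \<in> carrier Q; x \<otimes> u = y\<rbrakk> \<Longrightarrow> ldiv x y = u"
  by (metis l_cancel_iff ldiv_closed mult_closed mult_ldiv)

lemma right_division_ex: "\<lbrakk>x \<in> carrier Q; y \<in> carrier Q\<rbrakk> \<Longrightarrow> \<exists>v\<in>carrier Q. v \<otimes> x = y"
  using right_division[of x y] by blast

lemma left_division_ex: "\<lbrakk>x \<in> carrier Q; y \<in> carrier Q\<rbrakk> \<Longrightarrow> \<exists>u\<in>carrier Q. x \<otimes> u = y"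
  using left_division[of x y] by blast

declare mult_closed [simp, intro] one_closed [simp, intro] l_one [simp] r_one [simp]

section \<open>The nucleus and left inner maps\<close>

definition nucleus :: "'a set"
  where "nucleus = {n \<in> carrier Q. \<forall>x\<in>carrier Q. \<forall>y\<in>carrier Q.
    n \<otimes> (x \<otimes> y) = (n \<otimes> x) \<otimes> y \<and> x \<otimes> (n \<otimes> y) = (x \<otimes> n) \<otimes> y \<and> x \<otimes> (y \<otimes> n) = (x \<otimes> y) \<otimes> n}"

lemma nucleusI:
  assumes "n \<in> carrier Q"
    and "\<And>x y. \<lbrakk>x \<in> carrier Q; y \<in> carrier Q\<rbrakk> \<Longrightarrow> n \<otimes> (x \<otimes> y) = (n \<otimes> x) \<otimes> y"
    and "\<And>x y. \<lbrakk>x \<in> carrier Q; y \<in> carrier Q\<rbrakk> \<Longrightarrow> x \<otimes> (n \<otimes> y) = (x \<otimes> n) \<otimes> y"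
    and "\<And>x y. \<lbrakk>x \<in> carrier Q; y \<in> carrier Q\<rbrakk> \<Longrightarrow> x \<otimes> (y \<otimes> n) = (x \<otimes> y) \<otimes> n"
  shows "n \<in> nucleus"
  using assms by (simp add: nucleus_def)

lemma nucleus_left: "\<lbrakk>n \<in> nucleus; x \<in> carrier Q; y \<in> carrier Q\<rbrakk> \<Longrightarrow> (n \<otimes> x) \<otimes> y = n \<otimes> (x \<otimes> y)"
  and nucleus_mid: "\<lbrakk>n \<in> nucleus; x \<in> carrier Q; y \<in> carrier Q\<rbrakk> \<Longrightarrow> (x \<otimes> n) \<otimes> y = x \<otimes> (n \<otimes> y)"
  and nucleus_right: "\<lbrakk>n \<in> nucleus; x \<in> carrier Q; y \<in> carrier Q\<rbrakk> \<Longrightarrow> (x \<otimes> y) \<otimes> n = x \<otimes> (y \<otimes> n)"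
  by (simp_all add: nucleus_def)

lemmas nucleus_assoc = nucleus_left nucleus_mid nucleus_right

lemma nucleus_closed [simp]: "n \<in> nucleus \<Longrightarrow> n \<in> carrier Q"
  by (simp add: nucleus_def)

lemma one_nucleus [simp]: "\<one> \<in> nucleus"
  by (rule nucleusI) simp_all

lemma mult_nucleus [simp]:
  assumes "m \<in> nucleus" "n \<in> nucleus"
  shows "m \<otimes> n \<in> nucleus"
proof -
  note [simp] = assms[THEN nucleus_closed]
  note m = nucleus_assoc[OF assms(1)] and n = nucleus_assoc[OF assms(2)]
  show ?thesis
  proof (rule nucleusI)
    fix x y assume [simp]: "x \<in> carrier Q" "y \<in> carrier Q"
    show "(m \<otimes> n) \<otimes> (x \<otimes> y) = ((m \<otimes> n) \<otimes> x) \<otimes> y"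
      by (simp add: m n)
    have "(x \<otimes> (m \<otimes> n)) \<otimes> y = ((x \<otimes> m) \<otimes> n) \<otimes> y"
      by (simp only: n(3) nucleus_closed assms \<open>x \<in> carrier Q\<close>)
    also have "\<dots> = (x \<otimes> m) \<otimes> (n \<otimes> y)"
      by (rule n(2)) simp_all
    also have "\<dots> = x \<otimes> ((m \<otimes> n) \<otimes> y)"
      by (simp add: m)
    finally show "x \<otimes> ((m \<otimes> n) \<otimes> y) = (x \<otimes> (m \<otimes> n)) \<otimes> y" ..
    have "(x \<otimes> y) \<otimes> (m \<otimes> n) = ((x \<otimes> y) \<otimes> m) \<otimes> n"
      by (simp only: n(3) nucleus_closed assms mult_closed \<open>x \<in> carrier Q\<close> \<open>y \<in> carrier Q\<close>)
    also have "\<dots> = x \<otimes> (y \<otimes> (m \<otimes> n))"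
      by (simp add: m(3) n(3))
    finally show "x \<otimes> (y \<otimes> (m \<otimes> n)) = (x \<otimes> y) \<otimes> (m \<otimes> n)" ..
  qed simp
qed

text \<open>Translations by \<open>m\<close> and by \<open>n\<close> undo each other. The left and
  right nuclear laws of \<open>m\<close> thus follow from those of \<open>n\<close> after cancelling
  \<open>n\<close>, and the middle law is that of \<open>n\<close> taken at
  \<open>x \<otimes> m\<close> and \<open>m \<otimes> y\<close>.\<close>

lemma nucleus_inverse:
  assumes "n \<in> nucleus"
  obtains m where "m \<in> nucleus" "m \<otimes> n = \<one>" "n \<otimes> m = \<one>"
proof -
  have n [simp]: "n \<in> carrier Q" using assms by simp
  obtain m where m [simp]: "m \<in> carrier Q" and nm: "n \<otimes> m = \<one>"
    using left_division_ex[of n \<one>] by auto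
  have "n \<otimes> (m \<otimes> n) = n \<otimes> \<one>"
    using nucleus_left[OF assms, of m n] nm by simp
  then have mn: "m \<otimes> n = \<one>"
    using l_cancel_iff[of n "m \<otimes> n" \<one>] by simp
  have nmx: "n \<otimes> (m \<otimes> x) = x" if "x \<in> carrier Q" for x
    using nucleus_left[OF assms, of m x] nm that by simp
  have xmn: "(x \<otimes> m) \<otimes> n = x" if "x \<in> carrier Q" for x
    using nucleus_right[OF assms, of x m] mn that by simp
  have mnx: "m \<otimes> (n \<otimes> x) = x" if "x \<in> carrier Q" for x
    using nmx[of "n \<otimes> x"] l_cancel_iff[of n "m \<otimes> (n \<otimes> x)" x] that by simp
  have *: "m \<otimes> (x \<otimes> y) = (m \<otimes> x) \<otimes> y \<and> x \<otimes> (m \<otimes> y) = (x \<otimes> m) \<otimes> y \<and> x \<otimes> (y \<otimes> m) = (x \<otimes> y) \<otimes> m"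
    if x [simp]: "x \<in> carrier Q" and y [simp]: "y \<in> carrier Q" for x y
  proof (intro conjI)
    have "n \<otimes> (m \<otimes> (x \<otimes> y)) = n \<otimes> ((m \<otimes> x) \<otimes> y)"
      using nucleus_left[OF assms, of "m \<otimes> x" y] by (simp add: nmx)
    then show "m \<otimes> (x \<otimes> y) = (m \<otimes> x) \<otimes> y"
      by (simp add: l_cancel_iff)
    show "x \<otimes> (m \<otimes> y) = (x \<otimes> m) \<otimes> y"
      using nucleus_mid[OF assms, of "x \<otimes> m" "m \<otimes> y"] by (simp add: nmx xmn)
    have "(x \<otimes> (y \<otimes> m)) \<otimes> n = ((x \<otimes> y) \<otimes> m) \<otimes> n"
      using nucleus_right[OF assms, of x "y \<otimes> m"] by (simp add: xmn)
    then show "x \<otimes> (y \<otimes> m) = (x \<otimes> y) \<otimes> m"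
      by (simp add: r_cancel_iff)
  qed
  have "m \<in> nucleus" by (rule nucleusI) (use * in auto)
  then show thesis using that mn nm by blast
qed

text \<open>With \<open>L_x\<close> for left translation by \<open>x\<close>, this is the standard
  inner mapping \<open>L_{xy}^{-1} L_x L_y\<close>.\<close>

definition left_inner :: "'a \<Rightarrow> 'a \<Rightarrow> 'a \<Rightarrow> 'a"
  where "left_inner x y z = ldiv (x \<otimes> y) (x \<otimes> (y \<otimes> z))"

lemma left_inner_closed [simp]:
  "\<lbrakk>x \<in> carrier Q; y \<in> carrier Q; z \<in> carrier Q\<rbrakk> \<Longrightarrow> left_inner x y z \<in> carrier Q"
  by (simp add: left_inner_def)

lemma mult_left_inner:
  "\<lbrakk>x \<in> carrier Q; y \<in> carrier Q; z \<in> carrier Q\<rbrakk>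
    \<Longrightarrow> (x \<otimes> y) \<otimes> left_inner x y z = x \<otimes> (y \<otimes> z)"
  by (simp add: left_inner_def)

lemma left_inner_nucleus:
  "\<lbrakk>x \<in> carrier Q; y \<in> carrier Q; n \<in> nucleus\<rbrakk> \<Longrightarrow> left_inner x y n = n"
  unfolding left_inner_def by (rule ldiv_eqI) (simp_all add: nucleus_right)

section \<open>Subloops and generated subloops\<close>

lemma subloopI:
  assumes "H \<subseteq> carrier Q" "\<one> \<in> H"
    and "\<And>x y. \<lbrakk>x \<in> H; y \<in> H\<rbrakk> \<Longrightarrow> x \<otimes> y \<in> H"
    and "\<And>x u. \<lbrakk>x \<in> H; u \<in> carrier Q; x \<otimes> u \<in> H\<rbrakk> \<Longrightarrow> u \<in> H"
    and "\<And>x v. \<lbrakk>x \<in> H; v \<in> carrier Q; v \<otimes> x \<in> H\<rbrakk> \<Longrightarrow> v \<in> H"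
  shows "subloop H Q"
proof -
  have C: "x \<in> carrier Q" if "x \<in> H" for x using that assms(1) by blast
  have "loop (Q\<lparr>carrier := H\<rparr>)"
  proof (unfold_locales, simp_all add: assms(2,3) C)
    fix x y assume xy: "x \<in> H" "y \<in> H"
    \<comment> \<open>Existence and uniqueness are inherited from \<open>Q\<close>; what remains is
      that the solution lies in \<open>H\<close>.\<close>
    show "\<exists>!u. u \<in> H \<and> x \<otimes> u = y"
      using left_division[OF xy[THEN C]] xy assms(4) C by blast
    show "\<exists>!v. v \<in> H \<and> v \<otimes> x = y"
      using right_division[OF xy[THEN C]] xy assms(5) C by blast
  qed
  with assms(1) show ?thesis by (simp add: subloop_def)
qed

lemma subloop_carrier: "subloop (carrier Q) Q"
  by (rule subloopI) simp_all

lemma subloopD: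
  assumes "subloop H Q"
  shows "H \<subseteq> carrier Q" and "\<one> \<in> H"
    and "\<lbrakk>x \<in> H; y \<in> H\<rbrakk> \<Longrightarrow> x \<otimes> y \<in> H"
    and "\<lbrakk>x \<in> H; u \<in> carrier Q; x \<otimes> u \<in> H\<rbrakk> \<Longrightarrow> u \<in> H"
    and "\<lbrakk>x \<in> H; v \<in> carrier Q; v \<otimes> x \<in> H\<rbrakk> \<Longrightarrow> v \<in> H"
proof -
  show H: "H \<subseteq> carrier Q" using assms by (simp add: subloop_def)
  interpret H: loop "Q\<lparr>carrier := H\<rparr>" using assms by (simp add: subloop_def)
  show "\<one> \<in> H" using H.one_closed by simp
  show "x \<otimes> y \<in> H" if "x \<in> H" "y \<in> H" for x y
    using H.mult_closed that by simp
  show "u \<in> H" if x: "x \<in> H" and u: "u \<in> carrier Q" and xu: "x \<otimes> u \<in> H"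
  proof -
    obtain u' where "u' \<in> H" "x \<otimes> u' = x \<otimes> u"
      using H.left_division_ex[of x "x \<otimes> u"] x xu by auto
    then show ?thesis using x u H l_cancel_iff[of x u' u] by blast
  qed
  show "v \<in> H" if x: "x \<in> H" and v: "v \<in> carrier Q" and vx: "v \<otimes> x \<in> H"
  proof -
    obtain v' where "v' \<in> H" "v' \<otimes> x = v \<otimes> x"
      using H.right_division_ex[of x "v \<otimes> x"] x vx by auto
    then show ?thesis using x v H r_cancel_iff[of x v' v] by blast
  qed
qed

lemma subset_subloop_generated: "S \<subseteq> carrier (subloop_generated Q S)"
  by (auto simp: subloop_generated_def)

lemma subloop_generated_least:
  "\<lbrakk>subloop H Q; S \<subseteq> H\<rbrakk> \<Longrightarrow> carrier (subloop_generated Q S) \<subseteq> H"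
  by (auto simp: subloop_generated_def)

lemma mult_subloop_generated [simp]: "mult (subloop_generated Q S) = mult Q"
  and one_subloop_generated [simp]: "one (subloop_generated Q S) = one Q"
  by (simp_all add: subloop_generated_def)

lemma subloop_subloop_generated:
  assumes "S \<subseteq> carrier Q"
  shows "subloop (carrier (subloop_generated Q S)) Q"
proof (rule subloopI)
  show "carrier (subloop_generated Q S) \<subseteq> carrier Q"
    by (rule subloop_generated_least[OF subloop_carrier assms])
next
  show "\<one> \<in> carrier (subloop_generated Q S)"
    unfolding subloop_generated_def using subloopD(2) by auto
next
  show "x \<otimes> y \<in> carrier (subloop_generated Q S)"
    if "x \<in> carrier (subloop_generated Q S)" "y \<in> carrier (subloop_generated Q S)" for x y
    using that unfolding subloop_generated_def by (auto dest: subloopD(3))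
next
  show "u \<in> carrier (subloop_generated Q S)"
    if "x \<in> carrier (subloop_generated Q S)" "u \<in> carrier Q"
      "x \<otimes> u \<in> carrier (subloop_generated Q S)" for x u
    using that unfolding subloop_generated_def by (auto dest: subloopD(4))
next
  show "v \<in> carrier (subloop_generated Q S)"
    if "x \<in> carrier (subloop_generated Q S)" "v \<in> carrier Q"
      "v \<otimes> x \<in> carrier (subloop_generated Q S)" for x v
    using that unfolding subloop_generated_def by (auto dest: subloopD(5))
qed

end

section \<open>The conjugacy laws and the normality of the nucleus\<close>

context cc_loop
begin

text \<open>Putting \<open>z = \<one>\<close> in the conjugacy law forces the function value to
  solve \<open>f \<otimes> x = x \<otimes> y\<close>. Any solution of this equation can therefore
  replace it, and the unspecified functions disappear from later arguments.\<close>

lemma lcc: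
  assumes [simp]: "f \<in> carrier Q" "x \<in> carrier Q" "y \<in> carrier Q" "z \<in> carrier Q"
    and "f \<otimes> x = x \<otimes> y"
  shows "f \<otimes> (x \<otimes> z) = x \<otimes> (y \<otimes> z)"
proof -
  obtain F where F: "F \<in> carrier Q \<rightarrow> carrier Q \<rightarrow> carrier Q"
    "\<And>x y z. \<lbrakk>x \<in> carrier Q; y \<in> carrier Q; z \<in> carrier Q\<rbrakk> \<Longrightarrow> x \<otimes> (y \<otimes> z) = F x y \<otimes> (x \<otimes> z)"
    using conjugacy_closed by blast
  have FC: "F x y \<in> carrier Q"
    using F(1) by (auto simp: Pi_iff)
  have "F x y \<otimes> x = f \<otimes> x"
    using F(2)[of x y \<one>] assms(5) by simp
  then have "F x y = f" using FC by (simp add: r_cancel_iff)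
  then show ?thesis using F(2)[of x y z] by simp
qed

lemma rcc:
  assumes [simp]: "g \<in> carrier Q" "x \<in> carrier Q" "y \<in> carrier Q" "z \<in> carrier Q"
    and "x \<otimes> g = y \<otimes> x"
  shows "(z \<otimes> x) \<otimes> g = (z \<otimes> y) \<otimes> x"
proof -
  obtain G where G: "G \<in> carrier Q \<rightarrow> carrier Q \<rightarrow> carrier Q"
    "\<And>x y z. \<lbrakk>x \<in> carrier Q; y \<in> carrier Q; z \<in> carrier Q\<rbrakk> \<Longrightarrow> (z \<otimes> y) \<otimes> x = (z \<otimes> x) \<otimes> G x y"
    using conjugacy_closed by blast
  have GC: "G x y \<in> carrier Q"
    using G(1) by (auto simp: Pi_iff)
  have "x \<otimes> G x y = x \<otimes> g"
    using G(2)[of x y \<one>] assms(5) by simp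
  then have "G x y = g" using GC by (simp add: l_cancel_iff)
  then show ?thesis using G(2)[of x y z] by simp
qed

text \<open>The conjugacy laws transport associativity from one position to the next:
  \<open>rcc\<close>, with \<open>v \<otimes> a = a \<otimes> y\<close>, takes the right position to
  the middle one, and \<open>lcc\<close>, with \<open>f \<otimes> a = a \<otimes> x\<close>, takes
  the middle one to the left.\<close>

lemma right_nuclear_imp_nucleus:
  assumes a [simp]: "a \<in> carrier Q"
    and right: "\<And>x y. \<lbrakk>x \<in> carrier Q; y \<in> carrier Q\<rbrakk> \<Longrightarrow> x \<otimes> (y \<otimes> a) = (x \<otimes> y) \<otimes> a"
  shows "a \<in> nucleus"
proof -
  have mid: "x \<otimes> (a \<otimes> y) = (x \<otimes> a) \<otimes> y"
    if [simp]: "x \<in> carrier Q" "y \<in> carrier Q" for x y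
  proof -
    obtain v where v [simp]: "v \<in> carrier Q" and "v \<otimes> a = a \<otimes> y"
      using right_division_ex[of a "a \<otimes> y"] by auto
    then show ?thesis using rcc[of y a v x] right[of x v] by simp
  qed
  have left: "a \<otimes> (x \<otimes> y) = (a \<otimes> x) \<otimes> y"
    if [simp]: "x \<in> carrier Q" "y \<in> carrier Q" for x y
  proof -
    obtain f where [simp]: "f \<in> carrier Q" and "f \<otimes> a = a \<otimes> x"
      using right_division_ex[of a "a \<otimes> x"] by auto
    then show ?thesis using lcc[of f a x y] mid[of f y] by simp
  qed
  show ?thesis using left mid right by (intro nucleusI) auto
qed

text \<open>By \<open>lcc\<close>, conjugation by a left translation maps left translations to left
  translations. Conjugating that of \<open>u\<close> by the left inner map thus gives the left
  translation by some \<open>v\<close>, and evaluation at \<open>\<one>\<close> identifies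
  \<open>v\<close> as the image of \<open>u\<close>.\<close>

lemma left_inner_mult:
  assumes [simp]: "x \<in> carrier Q" "y \<in> carrier Q" "u \<in> carrier Q" "z \<in> carrier Q"
  shows "left_inner x y (u \<otimes> z) = left_inner x y u \<otimes> left_inner x y z"
proof -
  obtain p where [simp]: "p \<in> carrier Q" and p: "p \<otimes> y = y \<otimes> u"
    using right_division_ex[of y "y \<otimes> u"] by auto
  obtain q where [simp]: "q \<in> carrier Q" and q: "q \<otimes> x = x \<otimes> p"
    using right_division_ex[of x "x \<otimes> p"] by auto
  obtain v where [simp]: "v \<in> carrier Q" and v: "(x \<otimes> y) \<otimes> v = q \<otimes> (x \<otimes> y)"
    using left_division_ex[of "x \<otimes> y" "q \<otimes> (x \<otimes> y)"] by auto
  have *: "left_inner x y (u \<otimes> w) = v \<otimes> left_inner x y w" if [simp]: "w \<in> carrier Q" for w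
  proof -
    have "(x \<otimes> y) \<otimes> (v \<otimes> left_inner x y w) = q \<otimes> ((x \<otimes> y) \<otimes> left_inner x y w)"
      using lcc[of q "x \<otimes> y" v "left_inner x y w"] v by simp
    also have "\<dots> = x \<otimes> (p \<otimes> (y \<otimes> w))"
      using lcc[of q x p "y \<otimes> w"] q by (simp add: mult_left_inner)
    also have "\<dots> = x \<otimes> (y \<otimes> (u \<otimes> w))"
      using lcc[of p y u w] p by simp
    finally show ?thesis
      unfolding left_inner_def[of x y "u \<otimes> w"] by (intro ldiv_eqI) simp_all
  qed
  show ?thesis using *[of \<one>] *[of z] left_inner_nucleus[of x y \<one>] by simp
qed

text \<open>An autotopism that combines both conjugacy laws: its components are left translation by
  \<open>x\<close>, the map \<open>S\<close> of the next lemma, and left followed by right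
  translation by \<open>x\<close>.\<close>

lemma mult_mult_ldiv:
  assumes [simp]: "x \<in> carrier Q" "y \<in> carrier Q" "z \<in> carrier Q"
  shows "(x \<otimes> y) \<otimes> ldiv x ((x \<otimes> z) \<otimes> x) = (x \<otimes> (y \<otimes> z)) \<otimes> x"
proof -
  obtain f where [simp]: "f \<in> carrier Q" and "f \<otimes> x = x \<otimes> y"
    using right_division_ex[of x "x \<otimes> y"] by auto
  then show ?thesis
    using lcc[of f x y z] rcc[of "ldiv x ((x \<otimes> z) \<otimes> x)" x "x \<otimes> z" f] by simp
qed

text \<open>
  Put \<open>M v = (x((yv)y))x\<close> and \<open>M' v = ((xy) \<lambda>v)(xy)\<close> with \<open>\<lambda>\<close> the left inner map of \<open>x, y\<close>. Both are third
  components of autotopisms with first component \<open>w \<mapsto> x(yw)\<close>, so \<open>W = M'\<inverse> M\<close> satisfies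
  \<open>W(wz) = w (W z)\<close>; this makes \<open>W\<close> right translation by the nuclear element \<open>W 1\<close>.
\<close>
lemma commutator_nuclear_factor:
  assumes [simp]: "x \<in> carrier Q" "y \<in> carrier Q"
  obtains n where "n \<in> nucleus" "(x \<otimes> y) \<otimes> x = (x \<otimes> n) \<otimes> (x \<otimes> y)"
proof -
  define S where "S x z = ldiv x ((x \<otimes> z) \<otimes> x)" for x z
  define M where "M v = (x \<otimes> ((y \<otimes> v) \<otimes> y)) \<otimes> x" for v
  define M' where "M' v = ((x \<otimes> y) \<otimes> left_inner x y v) \<otimes> (x \<otimes> y)" for v
  have S_closed [simp]: "S x z \<in> carrier Q" if "x \<in> carrier Q" "z \<in> carrier Q" for x z
    using that by (simp add: S_def)
  have S: "(x \<otimes> y) \<otimes> S x z = (x \<otimes> (y \<otimes> z)) \<otimes> x"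
    if "x \<in> carrier Q" "y \<in> carrier Q" "z \<in> carrier Q" for x y z
    using that by (simp add: S_def mult_mult_ldiv)
  have M'_inj: "v = w" if "M' v = M' w" and [simp]: "v \<in> carrier Q" "w \<in> carrier Q" for v w
    using that(1) by (simp add: M'_def r_cancel_iff mult_left_inner l_cancel_iff)
  have shift: "\<exists>z'\<in>carrier Q. \<forall>w\<in>carrier Q. M (w \<otimes> z) = M' (w \<otimes> z')"
    if [simp]: "z \<in> carrier Q" for z
  proof -
    let ?u = "x \<otimes> y"
    \<comment> \<open>The element \<open>z'\<close> is found by solving backwards, so that the
      second components of the two autotopisms agree at \<open>z\<close> and
      \<open>z'\<close>.\<close>
    obtain s where [simp]: "s \<in> carrier Q" and s: "s \<otimes> ?u = ?u \<otimes> S x (S y z)"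
      using right_division_ex[of ?u "?u \<otimes> S x (S y z)"] by auto
    obtain r where [simp]: "r \<in> carrier Q" and r: "x \<otimes> r = s"
      using left_division_ex[of x s] by auto
    obtain z' where [simp]: "z' \<in> carrier Q" and z': "y \<otimes> z' = r"
      using left_division_ex[of y r] by auto
    have Sz': "S ?u (left_inner x y z') = S x (S y z)"
      unfolding S_def[of ?u] by (intro ldiv_eqI) (simp_all add: mult_left_inner z' r s)
    have "M (w \<otimes> z) = M' (w \<otimes> z')" if [simp]: "w \<in> carrier Q" for w
    proof -
      have "M (w \<otimes> z) = (x \<otimes> (y \<otimes> w)) \<otimes> S x (S y z)"
        using S[of x "y \<otimes> w" "S y z"] S[of y w z] by (simp add: M_def)
      also have "\<dots> = (?u \<otimes> left_inner x y w) \<otimes> S ?u (left_inner x y z')"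
        by (simp add: mult_left_inner Sz')
      also have "\<dots> = M' (w \<otimes> z')"
        by (simp add: M'_def S left_inner_mult)
      finally show ?thesis .
    qed
    then show ?thesis by (intro bexI[of _ z']) auto
  qed
  obtain n where [simp]: "n \<in> carrier Q"
    and n1: "\<And>w. w \<in> carrier Q \<Longrightarrow> M (w \<otimes> \<one>) = M' (w \<otimes> n)"
    using shift[of \<one>] one_closed by blast
  have n: "M w = M' (w \<otimes> n)" if "w \<in> carrier Q" for w
    using n1[OF that] that by simp
  have "w \<otimes> (z \<otimes> n) = (w \<otimes> z) \<otimes> n" if [simp]: "w \<in> carrier Q" "z \<in> carrier Q" for w z
  proof -
    obtain z' where [simp]: "z' \<in> carrier Q"
      and z': "\<And>w. w \<in> carrier Q \<Longrightarrow> M (w \<otimes> z) = M' (w \<otimes> z')"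
      using shift[of z] \<open>z \<in> carrier Q\<close> by blast
    have "M' z' = M' (z \<otimes> n)"
      using z'[of \<one>] n[of z] by simp
    then have "z' = z \<otimes> n"
      by (rule M'_inj) simp_all
    moreover have "M' (w \<otimes> z') = M' ((w \<otimes> z) \<otimes> n)"
      using z'[of w] n[of "w \<otimes> z"] by simp
    then have "w \<otimes> z' = (w \<otimes> z) \<otimes> n"
      by (rule M'_inj) simp_all
    ultimately show ?thesis by simp
  qed
  then have nuc: "n \<in> nucleus" by (intro right_nuclear_imp_nucleus) simp_all
  \<comment> \<open>At the right inverse \<open>w\<close> of \<open>y\<close>, the inner products
    \<open>y \<otimes> w\<close> collapse in both \<open>M w\<close> and
    \<open>M' (w \<otimes> n)\<close>.\<close>
  obtain w where [simp]: "w \<in> carrier Q" and w: "y \<otimes> w = \<one>"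
    using left_division_ex[of y \<one>] by auto
  have "(x \<otimes> y) \<otimes> x = M w"
    by (simp add: M_def w)
  also have "\<dots> = ((x \<otimes> y) \<otimes> (left_inner x y w \<otimes> n)) \<otimes> (x \<otimes> y)"
    using n[of w] nuc by (simp add: M'_def left_inner_mult left_inner_nucleus)
  also have "\<dots> = (((x \<otimes> y) \<otimes> left_inner x y w) \<otimes> n) \<otimes> (x \<otimes> y)"
    using nuc by (simp add: nucleus_right)
  also have "\<dots> = (x \<otimes> n) \<otimes> (x \<otimes> y)"
    by (simp add: mult_left_inner w)
  finally show thesis using that nuc by blast
qed

text \<open>By \<open>rcc\<close>, conjugation by the right translation of \<open>x\<close> maps
  right translations to right translations, and it takes that of \<open>n\<close> to that of
  \<open>m\<close>. Right nuclearity says that translating by \<open>q\<close> and then by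
  \<open>n\<close> is translating by \<open>q \<otimes> n\<close>; this property passes to
  \<open>m\<close>.\<close>

lemma nucleus_normal:
  assumes n: "n \<in> nucleus" and x [simp]: "x \<in> carrier Q"
  obtains m where "m \<in> nucleus" "n \<otimes> x = x \<otimes> m"
proof -
  have n' [simp]: "n \<in> carrier Q" using n by simp
  define m where "m = ldiv x (n \<otimes> x)"
  have m [simp]: "m \<in> carrier Q" and xm: "x \<otimes> m = n \<otimes> x" by (simp_all add: m_def)
  have conj: "(u \<otimes> x) \<otimes> m = (u \<otimes> n) \<otimes> x" if "u \<in> carrier Q" for u
    using rcc[of m x n u] xm that by simp
  have "y \<otimes> (z \<otimes> m) = (y \<otimes> z) \<otimes> m" if [simp]: "y \<in> carrier Q" "z \<in> carrier Q" for y z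
  proof -
    obtain q where [simp]: "q \<in> carrier Q" and q: "q \<otimes> x = x \<otimes> z"
      using right_division_ex[of x "x \<otimes> z"] by auto
    obtain v where [simp]: "v \<in> carrier Q" and v: "x \<otimes> v = (q \<otimes> n) \<otimes> x"
      using left_division_ex[of x "(q \<otimes> n) \<otimes> x"] by auto
    have *: "y \<otimes> v = (y \<otimes> z) \<otimes> m" if [simp]: "y \<in> carrier Q" for y
    proof -
      obtain p where [simp]: "p \<in> carrier Q" and p: "p \<otimes> x = y"
        using right_division_ex[of x y] by auto
      have "y \<otimes> v = (p \<otimes> (q \<otimes> n)) \<otimes> x"
        using rcc[of v x "q \<otimes> n" p] p v by simp
      also have "\<dots> = ((p \<otimes> q) \<otimes> x) \<otimes> m"
        using n by (simp add: conj nucleus_right)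
      also have "\<dots> = (y \<otimes> z) \<otimes> m"
        using rcc[of z x q p] p q by simp
      finally show ?thesis .
    qed
    show ?thesis using *[of y] *[of \<one>] by simp
  qed
  then have "m \<in> nucleus" by (simp add: right_nuclear_imp_nucleus)
  then show thesis using that xm by metis
qed

text \<open>Conjugation by \<open>x\<close> is onto the nucleus: moving \<open>n\<close> past a left
  inverse \<open>w\<close> of \<open>x\<close> produces the preimage \<open>m\<close>, since moving
  \<open>m\<close> back past \<open>x\<close> returns \<open>n\<close>.\<close>

lemma nucleus_normal':
  assumes n: "n \<in> nucleus" and x [simp]: "x \<in> carrier Q"
  obtains m where "m \<in> nucleus" "x \<otimes> n = m \<otimes> x"
proof -
  obtain w where w [simp]: "w \<in> carrier Q" and wx: "w \<otimes> x = \<one>"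
    using right_division_ex[of x \<one>] by auto
  obtain m where m: "m \<in> nucleus" and nw: "n \<otimes> w = w \<otimes> m"
    by (rule nucleus_normal[OF n w])
  obtain k where k: "k \<in> nucleus" and mx: "m \<otimes> x = x \<otimes> k"
    by (rule nucleus_normal[OF m x])
  have "n = (n \<otimes> w) \<otimes> x"
    using nucleus_left[OF n w x] n wx by simp
  also have "\<dots> = w \<otimes> (x \<otimes> k)"
    using nucleus_mid[OF m w x] by (simp add: nw mx)
  also have "\<dots> = k"
    using nucleus_right[OF k w x] k wx by simp
  finally show thesis using that[OF m] mx by simp
qed

section \<open>Basarab's theorem: the quotient by the nucleus is an abelian group\<close>

definition nuc_cong :: "'a \<Rightarrow> 'a \<Rightarrow> bool"  (infix \<open>\<sim>\<close> 50)
  where "x \<sim> y \<longleftrightarrow> x \<in> carrier Q \<and> (\<exists>n\<in>nucleus. y = x \<otimes> n)"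

lemma nuc_cong_closed: "x \<sim> y \<Longrightarrow> x \<in> carrier Q" "x \<sim> y \<Longrightarrow> y \<in> carrier Q"
  by (auto simp: nuc_cong_def)

lemma nuc_congI: "\<lbrakk>x \<in> carrier Q; n \<in> nucleus; y = x \<otimes> n\<rbrakk> \<Longrightarrow> x \<sim> y"
  by (auto simp: nuc_cong_def)

lemma nuc_congE:
  assumes "x \<sim> y"
  obtains n where "n \<in> nucleus" "y = x \<otimes> n"
  using assms by (auto simp: nuc_cong_def)

lemma nuc_cong_sym:
  assumes "x \<sim> y"
  shows "y \<sim> x"
proof -
  note [simp] = nuc_cong_closed[OF assms]
  obtain n where n: "n \<in> nucleus" "y = x \<otimes> n" by (rule nuc_congE[OF assms])
  obtain m where m: "m \<in> nucleus" "n \<otimes> m = \<one>" by (rule nucleus_inverse[OF n(1)])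
  show ?thesis
    by (rule nuc_congI[of _ m]) (use n m nucleus_right[OF m(1), of x n] in simp_all)
qed

lemma nuc_cong_trans [trans]:
  assumes "x \<sim> y" "y \<sim> z"
  shows "x \<sim> z"
proof -
  obtain n where n: "n \<in> nucleus" "y = x \<otimes> n" by (rule nuc_congE[OF assms(1)])
  obtain m where m: "m \<in> nucleus" "z = y \<otimes> m" by (rule nuc_congE[OF assms(2)])
  show ?thesis
    by (rule nuc_congI[of _ "n \<otimes> m"])
      (use n m nuc_cong_closed[OF assms(1)] in \<open>simp_all add: nucleus_right\<close>)
qed

lemma nuc_cong_mult_left:
  assumes "x \<sim> y" and [simp]: "z \<in> carrier Q"
  shows "z \<otimes> x \<sim> z \<otimes> y"
proof -
  obtain n where n: "n \<in> nucleus" "y = x \<otimes> n" by (rule nuc_congE[OF assms(1)])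
  show ?thesis
    by (rule nuc_congI[of _ n])
      (use n nuc_cong_closed[OF assms(1)] in \<open>simp_all add: nucleus_right\<close>)
qed

lemma mult_nuc_cong_swap:
  assumes [simp]: "x \<in> carrier Q" "y \<in> carrier Q"
  shows "x \<otimes> y \<sim> y \<otimes> x"
proof -
  have *: "x \<otimes> u \<sim> u \<otimes> x" if [simp]: "x \<in> carrier Q" "u \<in> carrier Q" for x u
  proof -
    \<comment> \<open>Every \<open>u\<close> has the form \<open>x \<otimes> y\<close>, so the
      nuclear factor of \<open>(x \<otimes> y) \<otimes> x\<close> controls the commutator of
      \<open>x\<close> and \<open>u\<close>.\<close>
    obtain y where [simp]: "y \<in> carrier Q" and y: "x \<otimes> y = u"
      using left_division_ex[of x u] by auto
    obtain n where n: "n \<in> nucleus" and "(x \<otimes> y) \<otimes> x = (x \<otimes> n) \<otimes> (x \<otimes> y)"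
      by (rule commutator_nuclear_factor[of x y]) simp_all
    then have ux: "u \<otimes> x = x \<otimes> (n \<otimes> u)"
      by (simp add: y nucleus_mid)
    obtain m where m: "m \<in> nucleus" "n \<otimes> u = u \<otimes> m"
      by (rule nucleus_normal[OF n, of u]) simp_all
    show ?thesis
      by (rule nuc_congI[of _ m]) (simp_all add: ux m nucleus_right)
  qed
  show ?thesis by (rule *) simp_all
qed

text \<open>Lets the auxiliary elements of \<open>rcc\<close> and, in the next lemma, of
  \<open>lcc\<close> be exchanged for \<open>y\<close> modulo the nucleus.\<close>

lemma commutator_nuclear_right:
  assumes [simp]: "x \<in> carrier Q" "y \<in> carrier Q" "g \<in> carrier Q" and g: "x \<otimes> g = y \<otimes> x"
  shows "y \<sim> g"
proof -
  obtain n where n: "n \<in> nucleus" "y \<otimes> x = (x \<otimes> y) \<otimes> n"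
    by (rule nuc_congE[OF mult_nuc_cong_swap[of x y]]) simp_all
  then have "x \<otimes> g = x \<otimes> (y \<otimes> n)" by (simp add: g nucleus_right)
  with n show ?thesis by (intro nuc_congI[of _ n]) (simp_all add: l_cancel_iff)
qed

lemma commutator_nuclear_left:
  assumes [simp]: "x \<in> carrier Q" "y \<in> carrier Q" "f \<in> carrier Q" and f: "f \<otimes> x = x \<otimes> y"
  shows "y \<sim> f"
  by (rule nuc_cong_sym, rule commutator_nuclear_right[of x]) (simp_all add: f)

lemma nuc_cong_mult_right:
  assumes "x \<sim> y" and [simp]: "z \<in> carrier Q"
  shows "x \<otimes> z \<sim> y \<otimes> z"
proof -
  note [simp] = nuc_cong_closed[OF assms(1)]
  have "x \<otimes> z \<sim> z \<otimes> x" by (rule mult_nuc_cong_swap) simp_all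
  also have "z \<otimes> x \<sim> z \<otimes> y" by (rule nuc_cong_mult_left[OF assms])
  also have "z \<otimes> y \<sim> y \<otimes> z" by (rule mult_nuc_cong_swap) simp_all
  finally show ?thesis .
qed

lemma mult_nuc_cong_left_commute:
  assumes [simp]: "x \<in> carrier Q" "y \<in> carrier Q" "z \<in> carrier Q"
  shows "y \<otimes> (x \<otimes> z) \<sim> x \<otimes> (y \<otimes> z)"
proof -
  obtain f where f [simp]: "f \<in> carrier Q" and fx: "f \<otimes> x = x \<otimes> y"
    using right_division_ex[of x "x \<otimes> y"] by auto
  have "y \<otimes> (x \<otimes> z) \<sim> f \<otimes> (x \<otimes> z)"
    by (rule nuc_cong_mult_right[OF commutator_nuclear_left[OF _ _ f fx]]) simp_all
  then show ?thesis using lcc[OF f _ _ _ fx] by simp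
qed

text \<open>Commutativity and left commutativity modulo the nucleus together yield associativity
  modulo the nucleus.\<close>

lemma mult_nuc_cong_assoc:
  assumes [simp]: "x \<in> carrier Q" "y \<in> carrier Q" "z \<in> carrier Q"
  shows "(x \<otimes> y) \<otimes> z \<sim> x \<otimes> (y \<otimes> z)"
proof -
  have "(x \<otimes> y) \<otimes> z \<sim> z \<otimes> (x \<otimes> y)" by (rule mult_nuc_cong_swap) simp_all
  also have "\<dots> \<sim> x \<otimes> (z \<otimes> y)" by (rule mult_nuc_cong_left_commute) simp_all
  also have "\<dots> \<sim> x \<otimes> (y \<otimes> z)"
    by (rule nuc_cong_mult_left[OF mult_nuc_cong_swap]) simp_all
  finally show ?thesis .
qed

section \<open>Associators and the centre of the nucleus\<close>

definition assoc :: "'a \<Rightarrow> 'a \<Rightarrow> 'a \<Rightarrow> 'a"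
  where "assoc x y z = ldiv ((x \<otimes> y) \<otimes> z) (x \<otimes> (y \<otimes> z))"

definition nucleus_center :: "'a set"
  where "nucleus_center = {u \<in> nucleus. \<forall>n\<in>nucleus. u \<otimes> n = n \<otimes> u}"

lemma nucleus_centerI:
  "\<lbrakk>u \<in> nucleus; \<And>n. n \<in> nucleus \<Longrightarrow> u \<otimes> n = n \<otimes> u\<rbrakk> \<Longrightarrow> u \<in> nucleus_center"
  by (simp add: nucleus_center_def)

lemma nucleus_center_commute:
  "\<lbrakk>u \<in> nucleus_center; n \<in> nucleus\<rbrakk> \<Longrightarrow> u \<otimes> n = n \<otimes> u"
  by (simp add: nucleus_center_def)

lemma nucleus_center_nucleus [simp]: "u \<in> nucleus_center \<Longrightarrow> u \<in> nucleus"
  by (simp add: nucleus_center_def)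

lemma assoc_nucleus [simp]:
  assumes [simp]: "x \<in> carrier Q" "y \<in> carrier Q" "z \<in> carrier Q"
  shows "assoc x y z \<in> nucleus"
proof -
  obtain n where n: "n \<in> nucleus" "x \<otimes> (y \<otimes> z) = ((x \<otimes> y) \<otimes> z) \<otimes> n"
    by (rule nuc_congE[OF mult_nuc_cong_assoc[of x y z]]) simp_all
  then have "assoc x y z = n"
    unfolding assoc_def by (intro ldiv_eqI) simp_all
  with n show ?thesis by simp
qed

lemma mult_assoc_eq:
  "\<lbrakk>x \<in> carrier Q; y \<in> carrier Q; z \<in> carrier Q\<rbrakk>
    \<Longrightarrow> ((x \<otimes> y) \<otimes> z) \<otimes> assoc x y z = x \<otimes> (y \<otimes> z)"
  by (simp add: assoc_def)

lemma left_inner_eq_mult_assoc: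
  assumes [simp]: "x \<in> carrier Q" "y \<in> carrier Q" "z \<in> carrier Q"
  shows "left_inner x y z = z \<otimes> assoc x y z"
  unfolding left_inner_def
  using nucleus_right[OF assoc_nucleus[of x y z], of "x \<otimes> y" z]
  by (intro ldiv_eqI) (simp_all add: mult_assoc_eq)

text \<open>The left inner map is multiplicative, fixes nuclear elements and sends \<open>z\<close>
  to \<open>z \<otimes> assoc x y z\<close>. Applying it to both sides of
  \<open>z \<otimes> n = m \<otimes> z\<close> shows that the associator commutes with
  \<open>n\<close>.\<close>

lemma assoc_nucleus_center [simp]:
  assumes [simp]: "x \<in> carrier Q" "y \<in> carrier Q" "z \<in> carrier Q"
  shows "assoc x y z \<in> nucleus_center"
proof -
  have "assoc x y z \<otimes> n = n \<otimes> assoc x y z" if n: "n \<in> nucleus" for n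
  proof -
    obtain m where m: "m \<in> nucleus" and zn: "z \<otimes> n = m \<otimes> z"
      by (rule nucleus_normal'[OF n, of z]) simp_all
    have "z \<otimes> (assoc x y z \<otimes> n) = left_inner x y (z \<otimes> n)"
      using n by (simp add: left_inner_mult left_inner_nucleus
          left_inner_eq_mult_assoc[of x y z] nucleus_right)
    also have "\<dots> = (m \<otimes> z) \<otimes> assoc x y z"
      using m by (simp add: zn left_inner_mult left_inner_nucleus
          left_inner_eq_mult_assoc[of x y z] nucleus_left)
    also have "\<dots> = z \<otimes> (n \<otimes> assoc x y z)"
      using n by (simp add: nucleus_mid flip: zn)
    finally show ?thesis using n by (simp add: l_cancel_iff)
  qed
  then show ?thesis by (intro nucleus_centerI) simp_all
qed

section \<open>The conjugation action\<close>

definition act :: "'a \<Rightarrow> 'a \<Rightarrow> 'a"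
  where "act x u = ldiv x (u \<otimes> x)"

lemma mult_act: "\<lbrakk>x \<in> carrier Q; u \<in> nucleus\<rbrakk> \<Longrightarrow> x \<otimes> act x u = u \<otimes> x"
  by (simp add: act_def)

lemma act_nucleus [simp]:
  assumes [simp]: "x \<in> carrier Q" and u: "u \<in> nucleus"
  shows "act x u \<in> nucleus"
proof -
  obtain m where m: "m \<in> nucleus" "u \<otimes> x = x \<otimes> m"
    by (rule nucleus_normal[OF u, of x]) simp_all
  then have "act x u = m"
    unfolding act_def by (intro ldiv_eqI) simp_all
  with m show ?thesis by simp
qed

lemma act_eqI:
  "\<lbrakk>x \<in> carrier Q; u \<in> nucleus; v \<in> nucleus; x \<otimes> v = u \<otimes> x\<rbrakk> \<Longrightarrow> act x u = v"
  unfolding act_def by (intro ldiv_eqI) simp_all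

lemma act_hom:
  assumes [simp]: "x \<in> carrier Q" "u \<in> nucleus" "v \<in> nucleus"
  shows "act x (u \<otimes> v) = act x u \<otimes> act x v"
proof (rule act_eqI)
  have "x \<otimes> (act x u \<otimes> act x v) = (u \<otimes> x) \<otimes> act x v"
    using nucleus_right[of "act x v" x "act x u"] mult_act[of x u] by simp
  also have "\<dots> = u \<otimes> (v \<otimes> x)"
    by (simp add: nucleus_left[of u] mult_act)
  also have "\<dots> = (u \<otimes> v) \<otimes> x"
    by (simp add: nucleus_left[of u])
  finally show "x \<otimes> (act x u \<otimes> act x v) = (u \<otimes> v) \<otimes> x" .
qed simp_all

text \<open>Conjugation of \<open>u\<close> to \<open>x^{-1} u x\<close> is a right action, hence
  the reversed order. The usual computation survives because nuclear elements associate with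
  everything.\<close>

lemma act_mult:
  assumes [simp]: "x \<in> carrier Q" "y \<in> carrier Q" "u \<in> nucleus"
  shows "act (x \<otimes> y) u = act y (act x u)"
proof (rule act_eqI)
  have "(x \<otimes> y) \<otimes> act y (act x u) = x \<otimes> (act x u \<otimes> y)"
    by (simp add: nucleus_right[of "act y (act x u)"] mult_act)
  also have "\<dots> = (u \<otimes> x) \<otimes> y"
    using nucleus_mid[of "act x u" x y] by (simp add: mult_act)
  finally show "(x \<otimes> y) \<otimes> act y (act x u) = u \<otimes> (x \<otimes> y)"
    by (simp add: nucleus_left[of u])
qed simp_all

lemma act_nucleus_trivial:
  "\<lbrakk>n \<in> nucleus; u \<in> nucleus_center\<rbrakk> \<Longrightarrow> act n u = u"
  by (intro act_eqI) (simp_all add: nucleus_center_commute)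

lemma act_one [simp]: "x \<in> carrier Q \<Longrightarrow> act x \<one> = \<one>"
  by (rule act_eqI) simp_all

text \<open>Conjugation by \<open>x\<close> is multiplicative and onto the nucleus by
  \<open>nucleus_normal'\<close>, so it preserves the centre.\<close>

lemma act_nucleus_center [simp]:
  assumes x [simp]: "x \<in> carrier Q" and u: "u \<in> nucleus_center"
  shows "act x u \<in> nucleus_center"
proof -
  have "act x u \<otimes> n = n \<otimes> act x u" if n: "n \<in> nucleus" for n
  proof -
    obtain m where m: "m \<in> nucleus" and "x \<otimes> n = m \<otimes> x"
      by (rule nucleus_normal'[OF n x])
    then have n_eq: "n = act x m"
      using n act_eqI[of x m n] by simp
    show ?thesis
      using act_hom[of x u m] act_hom[of x m u] nucleus_center_commute[OF u m] m u
      by (simp add: n_eq)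
  qed
  then show ?thesis using u by (intro nucleus_centerI) simp_all
qed

text \<open>The nucleus acts trivially on its own centre, so the action factors through the abelian
  quotient; this is why conjugations commute there.\<close>

lemma act_nuc_cong:
  assumes "x \<sim> y" "u \<in> nucleus_center"
  shows "act x u = act y u"
proof -
  obtain n where n: "n \<in> nucleus" "y = x \<otimes> n" by (rule nuc_congE[OF assms(1)])
  then show ?thesis
    using assms nuc_cong_closed[OF assms(1)] by (simp add: act_mult act_nucleus_trivial)
qed

lemma act_commute:
  assumes "x \<in> carrier Q" "y \<in> carrier Q" "u \<in> nucleus_center"
  shows "act x (act y u) = act y (act x u)"
  using act_nuc_cong[OF mult_nuc_cong_swap[of x y], of u] assms by (simp add: act_mult)

section \<open>Product rule, congruence and symmetry of associators\<close>

lemma assoc_mult_right: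
  assumes [simp]: "x \<in> carrier Q" "y \<in> carrier Q" "z \<in> carrier Q" "w \<in> carrier Q"
  shows "assoc x y (z \<otimes> w) = act w (assoc x y z) \<otimes> assoc x y w"
proof -
  define a where "a = assoc x y z"
  define b where "b = assoc x y w"
  have [simp]: "a \<in> nucleus" "b \<in> nucleus" by (simp_all add: a_def b_def)
  have "(z \<otimes> w) \<otimes> assoc x y (z \<otimes> w) = (z \<otimes> a) \<otimes> (w \<otimes> b)"
    using left_inner_mult[of x y z w] by (simp add: left_inner_eq_mult_assoc a_def b_def)
  also have "\<dots> = ((z \<otimes> a) \<otimes> w) \<otimes> b"
    using nucleus_right[of b "z \<otimes> a" w] by simp
  \<comment> \<open>Moving \<open>a\<close> to the right past \<open>w\<close> conjugates it; this
    is the source of the twist in the product rule.\<close>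
  also have "(z \<otimes> a) \<otimes> w = z \<otimes> (w \<otimes> act w a)"
    using nucleus_mid[of a z w] by (simp add: mult_act)
  also have "\<dots> = (z \<otimes> w) \<otimes> act w a"
    by (simp add: nucleus_right[of "act w a"])
  also have "\<dots> \<otimes> b = (z \<otimes> w) \<otimes> (act w a \<otimes> b)"
    by (simp add: nucleus_right[of b])
  finally show ?thesis by (simp add: l_cancel_iff a_def b_def)
qed

lemma assoc_nuclear_right: "\<lbrakk>x \<in> carrier Q; y \<in> carrier Q; n \<in> nucleus\<rbrakk> \<Longrightarrow> assoc x y n = \<one>"
  unfolding assoc_def by (rule ldiv_eqI) (simp_all add: nucleus_right)

lemma assoc_cong_right:
  assumes "z \<sim> z'" and [simp]: "x \<in> carrier Q" "y \<in> carrier Q"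
  shows "assoc x y z = assoc x y z'"
proof -
  note [simp] = nuc_cong_closed[OF assms(1)]
  obtain n where n: "n \<in> nucleus" "z' = z \<otimes> n" by (rule nuc_congE[OF assms(1)])
  then show ?thesis by (simp add: assoc_mult_right assoc_nuclear_right act_nucleus_trivial)
qed

text \<open>A nuclear factor of the middle argument slides to the front of the third, and normality
  moves it to the end, where \<open>assoc_cong_right\<close> absorbs it. The left argument is
  treated by one more slide.\<close>

lemma assoc_cong_mid:
  assumes "y \<sim> y'" and [simp]: "x \<in> carrier Q" "z \<in> carrier Q"
  shows "assoc x y z = assoc x y' z"
proof -
  note [simp] = nuc_cong_closed[OF assms(1)]
  obtain n where n: "n \<in> nucleus" "y' = y \<otimes> n" by (rule nuc_congE[OF assms(1)])
  obtain m where m: "m \<in> nucleus" "n \<otimes> z = z \<otimes> m"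
    by (rule nucleus_normal[OF n(1), of z]) simp_all
  have "assoc x y' z = assoc x y (n \<otimes> z)"
    unfolding assoc_def using n nucleus_mid[OF n(1), of "x \<otimes> y" z]
    by (simp add: nucleus_mid nucleus_right[OF n(1), symmetric])
  also have "\<dots> = assoc x y z"
    using m by (intro assoc_cong_right[symmetric] nuc_congI) simp_all
  finally show ?thesis ..
qed

lemma assoc_cong_left:
  assumes "x \<sim> x'" and [simp]: "y \<in> carrier Q" "z \<in> carrier Q"
  shows "assoc x y z = assoc x' y z"
proof -
  note [simp] = nuc_cong_closed[OF assms(1)]
  obtain n where n: "n \<in> nucleus" "x' = x \<otimes> n" by (rule nuc_congE[OF assms(1)])
  obtain m where m: "m \<in> nucleus" "n \<otimes> y = y \<otimes> m"
    by (rule nucleus_normal[OF n(1), of y]) simp_all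
  have "assoc x' y z = assoc x (n \<otimes> y) z"
    unfolding assoc_def using n by (simp add: nucleus_mid nucleus_left)
  also have "\<dots> = assoc x y z"
    using m by (intro assoc_cong_mid[symmetric] nuc_congI) simp_all
  finally show ?thesis ..
qed

text \<open>For \<open>f \<otimes> x = x \<otimes> y\<close>, \<open>lcc\<close> makes the
  associators of \<open>x, y, z\<close> and of \<open>f, x, z\<close> literally equal, and
  \<open>f\<close> is congruent to \<open>y\<close>. The mirror argument with \<open>rcc\<close>
  swaps the last two arguments.\<close>

lemma assoc_swap_left:
  assumes [simp]: "x \<in> carrier Q" "y \<in> carrier Q" "z \<in> carrier Q"
  shows "assoc x y z = assoc y x z"
proof -
  obtain f where f [simp]: "f \<in> carrier Q" and fx: "f \<otimes> x = x \<otimes> y"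
    using right_division_ex[of x "x \<otimes> y"] by auto
  have "assoc x y z = assoc f x z"
    using lcc[of f x y z] by (simp add: assoc_def fx)
  also have "\<dots> = assoc y x z"
    by (rule assoc_cong_left[symmetric, OF commutator_nuclear_left[OF _ _ f fx]]) simp_all
  finally show ?thesis .
qed

lemma assoc_swap_right:
  assumes [simp]: "x \<in> carrier Q" "y \<in> carrier Q" "z \<in> carrier Q"
  shows "assoc z x y = assoc z y x"
proof -
  obtain g where g [simp]: "g \<in> carrier Q" and xg: "x \<otimes> g = y \<otimes> x"
    using left_division_ex[of x "y \<otimes> x"] by auto
  have "assoc z x y = assoc z x g"
    by (rule assoc_cong_right[OF commutator_nuclear_right[OF _ _ g xg]]) simp_all
  also have "\<dots> = assoc z y x"
    using rcc[of g x y z] by (simp add: assoc_def xg)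
  finally show ?thesis .
qed

section \<open>The abelian group structure of the centre of the nucleus\<close>

lemma nucleus_center_assoc:
  "\<lbrakk>u \<in> nucleus_center; v \<in> nucleus_center; w \<in> nucleus_center\<rbrakk>
    \<Longrightarrow> (u \<otimes> v) \<otimes> w = u \<otimes> (v \<otimes> w)"
  by (simp add: nucleus_left)

lemma nucleus_center_comm:
  "\<lbrakk>u \<in> nucleus_center; v \<in> nucleus_center\<rbrakk> \<Longrightarrow> u \<otimes> v = v \<otimes> u"
  by (simp add: nucleus_center_commute)

lemma nucleus_center_left_comm:
  "\<lbrakk>u \<in> nucleus_center; v \<in> nucleus_center; w \<in> nucleus_center\<rbrakk>
    \<Longrightarrow> u \<otimes> (v \<otimes> w) = v \<otimes> (u \<otimes> w)"
  by (metis nucleus_center_assoc nucleus_center_comm)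

lemmas nucleus_center_ac = nucleus_center_assoc nucleus_center_comm nucleus_center_left_comm

lemma one_nucleus_center [simp]: "\<one> \<in> nucleus_center"
  by (rule nucleus_centerI) simp_all

lemma mult_nucleus_center [simp]:
  assumes u: "u \<in> nucleus_center" and v: "v \<in> nucleus_center"
  shows "u \<otimes> v \<in> nucleus_center"
proof (rule nucleus_centerI)
  fix n assume n: "n \<in> nucleus"
  have "(u \<otimes> v) \<otimes> n = u \<otimes> (n \<otimes> v)"
    using u v n by (simp add: nucleus_left nucleus_center_commute)
  also have "\<dots> = (n \<otimes> u) \<otimes> v"
    using u v n nucleus_left[of u n v] nucleus_center_commute[OF u n] by simp
  also have "\<dots> = n \<otimes> (u \<otimes> v)"
    using u v n by (simp add: nucleus_left)
  finally show "(u \<otimes> v) \<otimes> n = n \<otimes> (u \<otimes> v)" .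
qed (use u v in simp_all)

lemma act_eq_oneD:
  assumes [simp]: "x \<in> carrier Q" "u \<in> nucleus" and "act x u = \<one>"
  shows "u = \<one>"
  using mult_act[of x u] r_cancel_iff[of x u \<one>] assms(3) by simp

text \<open>Applied to central nuclear elements, and nested to the right to match the normal form of
  \<open>nucleus_center_ac\<close>.\<close>

definition cube :: "'a \<Rightarrow> 'a"
  where "cube u = u \<otimes> (u \<otimes> u)"

lemma cube_nucleus_center [simp]: "u \<in> nucleus_center \<Longrightarrow> cube u \<in> nucleus_center"
  by (simp add: cube_def)

lemma cube_mult:
  "\<lbrakk>u \<in> nucleus_center; v \<in> nucleus_center\<rbrakk> \<Longrightarrow> cube (u \<otimes> v) = cube u \<otimes> cube v"
  by (simp add: cube_def nucleus_center_ac)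

lemma act_cube: "\<lbrakk>x \<in> carrier Q; u \<in> nucleus_center\<rbrakk> \<Longrightarrow> act x (cube u) = cube (act x u)"
  by (simp add: cube_def act_hom)

section \<open>Subloops on which associators vanish\<close>

lemma subloop_assoc_kernel:
  assumes [simp]: "x \<in> carrier Q" "y \<in> carrier Q"
  shows "subloop {z \<in> carrier Q. assoc x y z = \<one>} Q"
proof (rule subloopI)
  fix z w
  assume z: "z \<in> {z \<in> carrier Q. assoc x y z = \<one>}" and w: "w \<in> carrier Q"
  then have [simp]: "z \<in> carrier Q" "w \<in> carrier Q" "assoc x y z = \<one>" by simp_all
  \<comment> \<open>By the product rule, \<open>assoc x y\<close> is a crossed homomorphism; as
    conjugation is injective, its kernel admits both divisions.\<close>
  show "w \<in> {z \<in> carrier Q. assoc x y z = \<one>}" if "z \<otimes> w \<in> {z \<in> carrier Q. assoc x y z = \<one>}"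
    using that by (simp add: assoc_mult_right)
  show "w \<in> {z \<in> carrier Q. assoc x y z = \<one>}" if "w \<otimes> z \<in> {z \<in> carrier Q. assoc x y z = \<one>}"
    using that act_eq_oneD[of z "assoc x y w"] by (simp add: assoc_mult_right)
qed (auto simp: assoc_mult_right assoc_nuclear_right)

text \<open>Triviality spreads from \<open>S\<close> to the generated subloop one argument at a
  time: the kernel of each \<open>assoc x y\<close> is a subloop, and symmetry rotates the next
  argument into last place.\<close>

lemma group_subloop_generated:
  assumes S: "S \<subseteq> carrier Q"
    and assoc: "\<And>x y z. \<lbrakk>x \<in> S; y \<in> S; z \<in> S\<rbrakk> \<Longrightarrow> assoc x y z = \<one>"
  shows "group (subloop_generated Q S)"
proof -
  let ?H = "carrier (subloop_generated Q S)"
  note H = subloopD[OF subloop_subloop_generated[OF S]]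
  have SC: "x \<in> carrier Q" if "x \<in> S" for x using that S by blast
  have HC: "x \<in> carrier Q" if "x \<in> ?H" for x using that H(1) by blast
  have extend: "assoc x y z = \<one>"
    if "x \<in> carrier Q" "y \<in> carrier Q" "\<And>s. s \<in> S \<Longrightarrow> assoc x y s = \<one>" "z \<in> ?H" for x y z
    using subloop_generated_least[OF subloop_assoc_kernel[OF that(1,2)], of S] that SC by blast
  have 1: "assoc x y z = \<one>" if "x \<in> S" "y \<in> S" "z \<in> ?H" for x y z
  proof (rule extend)
    show "assoc x y s = \<one>" if "s \<in> S" for s
      using \<open>x \<in> S\<close> \<open>y \<in> S\<close> that by (rule assoc)
  qed (use that SC in simp_all)
  have 2: "assoc x z y = \<one>" if "x \<in> S" "y \<in> ?H" "z \<in> ?H" for x y z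
  proof (rule extend)
    show "assoc x z s = \<one>" if "s \<in> S" for s
      using 1[of x s z] \<open>x \<in> S\<close> \<open>z \<in> ?H\<close> that assoc_swap_right[of z s x] SC HC by simp
  qed (use that SC HC in simp_all)
  have 3: "assoc y z x = \<one>" if "x \<in> ?H" "y \<in> ?H" "z \<in> ?H" for x y z
  proof (rule extend)
    show "assoc y z s = \<one>" if "s \<in> S" for s
      using 2[of s z y] \<open>y \<in> ?H\<close> \<open>z \<in> ?H\<close> that
        assoc_swap_right[of z s y] assoc_swap_left[of s y z] SC HC by simp
  qed (use that SC HC in simp_all)
  have "(x \<otimes> y) \<otimes> z = x \<otimes> (y \<otimes> z)" if "x \<in> ?H" "y \<in> ?H" "z \<in> ?H" for x y z
    using mult_assoc_eq[of x y z] 3[of z x y] that HC by simp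
  moreover have "\<exists>y\<in>?H. y \<otimes> x = \<one>" if "x \<in> ?H" for x
  proof -
    obtain v where v: "v \<in> carrier Q" "v \<otimes> x = \<one>"
      using right_division_ex[of x \<one>] HC[OF \<open>x \<in> ?H\<close>] by blast
    then have "v \<in> ?H" using H(5)[of x v] H(2) that by simp
    with v show ?thesis by blast
  qed
  ultimately show ?thesis
    using H(2,3) HC by (intro groupI) simp_all
qed

end

section \<open>Associators of two elements under power-associativity\<close>

locale pacc_loop = power_associative_loop + cc_loop
begin

lemma assoc_diag [simp]:
  assumes [simp]: "x \<in> carrier Q"
  shows "assoc x x x = \<one>"
proof -
  have "monoid (subloop_generated Q {x})"
    by (rule group.is_monoid[OF power_associative]) (rule assms)
  moreover have "x \<in> carrier (subloop_generated Q {x})"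
    using subset_subloop_generated[of "{x}"] by blast
  ultimately have *: "(x \<otimes> x) \<otimes> x = x \<otimes> (x \<otimes> x)"
    using monoid.m_assoc[of "subloop_generated Q {x}" x x x] by simp
  show ?thesis
    unfolding assoc_def by (rule ldiv_eqI) (simp_all add: *)
qed

text \<open>Expand the equal associators \<open>assoc x x (y \<otimes> x)\<close> and
  \<open>assoc x x (x \<otimes> y)\<close> by the product rule; \<open>assoc x x x\<close> drops
  out.\<close>

lemma act_assoc_left:
  assumes [simp]: "x \<in> carrier Q" "y \<in> carrier Q"
  shows "act x (assoc x x y) = assoc x x y"
  using assoc_cong_right[OF mult_nuc_cong_swap[of y x], of x x] by (simp add: assoc_mult_right)

lemma act_assoc_right:
  assumes [simp]: "x \<in> carrier Q" "y \<in> carrier Q"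
  shows "act y (assoc x y y) = assoc x y y"
  using act_assoc_left[of y x] by (simp add: assoc_swap_left[of x y y] assoc_swap_right[of x y y])

text \<open>The two sides are the expansions of \<open>assoc x y (x \<otimes> y)\<close> and
  \<open>assoc x y (y \<otimes> x)\<close>.\<close>

lemma act_assoc_balance:
  assumes [simp]: "x \<in> carrier Q" "y \<in> carrier Q"
  shows "act y (assoc x x y) \<otimes> assoc x y y = act x (assoc x y y) \<otimes> assoc x x y"
  using assoc_cong_right[OF mult_nuc_cong_swap[of x y], of x y]
  by (simp add: assoc_mult_right assoc_swap_right[of x y x])

lemma cube_assoc_mult:
  assumes [simp]: "x \<in> carrier Q" "y \<in> carrier Q"
  shows "cube (assoc x x y) \<otimes> cube (assoc x y y) = \<one>"
proof -
  define u P R where "u = x \<otimes> y" and "P = assoc x x y" and "R = assoc x y y"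
  have [simp]: "u \<in> carrier Q" "P \<in> nucleus_center" "R \<in> nucleus_center"
    by (simp_all add: u_def P_def R_def)
  have yR: "act y R = R" by (simp add: R_def act_assoc_right)
  \<comment> \<open>Each occurrence of \<open>u\<close> is expanded in the last argument, with
    symmetry bringing the next one there, until \<open>assoc u u u\<close> is expressed by
    \<open>P\<close> and \<open>R\<close>.\<close>
  have mult: "assoc v w u = act y (assoc v w x) \<otimes> assoc v w y"
    if "v \<in> carrier Q" "w \<in> carrier Q" for v w
    using that by (simp add: u_def assoc_mult_right)
  have xxu: "assoc x x u = P"
    by (simp add: mult P_def)
  have xyu: "assoc x y u = act y P \<otimes> R"
    using assoc_swap_right[of x y x] by (simp add: mult P_def R_def)
  have yyx: "assoc y y x = R"
    using assoc_swap_left[of x y y] assoc_swap_right[of x y y] by (simp add: R_def)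
  have yyu: "assoc y y u = R"
    by (simp add: mult yyx yR)
  have xuu: "assoc x u u = act y P \<otimes> (act y P \<otimes> R)"
    using assoc_swap_right[of x u x] assoc_swap_right[of y u x]
    by (simp add: mult[of x u] xxu xyu)
  have yuu: "assoc y u u = act y (act y P \<otimes> R) \<otimes> R"
    using assoc_swap_right[of x u y] assoc_swap_right[of y u y] assoc_swap_left[of y x u]
    by (simp add: mult[of y u] xyu yyu)
  have uux: "assoc u u x = act y P \<otimes> (act y P \<otimes> R)"
    using assoc_swap_right[of x u u] assoc_swap_left[of x u u] by (simp add: xuu)
  have uuy: "assoc u u y = act y (act y P \<otimes> R) \<otimes> R"
    using assoc_swap_right[of y u u] assoc_swap_left[of y u u] by (simp add: yuu)
  have "assoc u u u = act y (assoc u u x) \<otimes> assoc u u y"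
    by (rule mult) simp_all
  also have "\<dots> = cube (act y (act y P)) \<otimes> cube R"
    by (simp add: uux uuy act_hom yR cube_def nucleus_center_ac)
  \<comment> \<open>As \<open>y\<close> fixes \<open>R\<close>, the action can be pulled out of the
    whole product and then removed by injectivity.\<close>
  also have "\<dots> = act y (act y (cube P \<otimes> cube R))"
    by (simp add: act_hom act_cube yR)
  finally have "act y (act y (cube P \<otimes> cube R)) = \<one>" by simp
  then have "cube P \<otimes> cube R = \<one>"
    using act_eq_oneD[of y "act y (cube P \<otimes> cube R)"] act_eq_oneD[of y "cube P \<otimes> cube R"] by simp
  then show ?thesis by (simp add: P_def R_def)
qed

text \<open>This cube is inverse to that of \<open>assoc x y y\<close>, which \<open>y\<close>
  fixes.\<close>

lemma act_cube_assoc_right: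
  assumes [simp]: "x \<in> carrier Q" "y \<in> carrier Q"
  shows "act y (cube (assoc x x y)) = cube (assoc x x y)"
proof -
  let ?P = "cube (assoc x x y)" and ?R = "cube (assoc x y y)"
  have "act y (?P \<otimes> ?R) = ?P \<otimes> ?R"
    by (simp add: cube_assoc_mult)
  then have "act y ?P \<otimes> ?R = ?P \<otimes> ?R"
    by (simp add: act_hom act_cube act_assoc_right)
  then show ?thesis by (simp add: r_cancel_iff)
qed

lemma act_cube_assoc_left:
  assumes [simp]: "x \<in> carrier Q" "y \<in> carrier Q"
  shows "act x (cube (assoc x x y)) = cube (assoc x x y)"
  by (simp add: act_cube act_assoc_left)

lemma cube_assoc_squared_and_symmetric:
  assumes [simp]: "x \<in> carrier Q" "y \<in> carrier Q"
  shows cube_assoc_squared: "cube (assoc x x y) \<otimes> cube (assoc x x y) = \<one>"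
    and cube_assoc_symmetric: "cube (assoc x y y) = cube (assoc x x y)"
proof -
  define P R where "P = assoc x x y" and "R = assoc x y y"
  have [simp]: "P \<in> nucleus_center" "R \<in> nucleus_center"
    by (simp_all add: P_def R_def)
  have yR: "act y R = R" by (simp add: R_def act_assoc_right)
  have PR: "cube P \<otimes> cube R = \<one>" unfolding P_def R_def by (rule cube_assoc_mult) simp_all
  have cP: "cube (act y P) = cube P"
    using act_cube_assoc_right[of x y] by (simp add: P_def act_cube)
  have "assoc x (y \<otimes> y) y = R \<otimes> R"
    using assoc_swap_right[of y "y \<otimes> y" x] yR by (simp add: assoc_mult_right R_def)
  then have "assoc x (y \<otimes> y) (y \<otimes> y) = (R \<otimes> R) \<otimes> (R \<otimes> R)"
    by (simp add: assoc_mult_right[of x "y \<otimes> y" y y] act_hom yR)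
  moreover have "assoc x x (y \<otimes> y) = act y P \<otimes> P"
    by (simp add: assoc_mult_right P_def)
  ultimately have "cube (act y P \<otimes> P) \<otimes> cube ((R \<otimes> R) \<otimes> (R \<otimes> R)) = \<one>"
    using cube_assoc_mult[of x "y \<otimes> y"] by simp
  \<comment> \<open>Passing from \<open>y\<close> to \<open>y \<otimes> y\<close> turns
    \<open>P\<close> into \<open>act y P \<otimes> P\<close> and \<open>R\<close> into its fourth
    power. The cubes then give \<open>P^6 R^12 = 1\<close>, and removing \<open>P^3 R^3 = 1\<close>
    twice leaves \<open>R^6 = 1\<close>.\<close>
  then have "(cube P \<otimes> cube R) \<otimes> ((cube P \<otimes> cube R) \<otimes> (cube R \<otimes> cube R)) = \<one>"
    by (simp add: cube_mult cP nucleus_center_ac)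
  then have RR: "cube R \<otimes> cube R = \<one>" by (simp add: PR)
  then have "cube P \<otimes> cube R = cube R \<otimes> cube R" by (simp add: PR)
  then have "cube P = cube R" by (simp add: r_cancel_iff)
  with RR show "cube (assoc x x y) \<otimes> cube (assoc x x y) = \<one>"
    and "cube (assoc x y y) = cube (assoc x x y)" by (simp_all add: P_def R_def)
qed

text \<open>Additively, this is \<open>(y - 1)^2 P = 0\<close>. The balance law reads
  \<open>(y - 1) P = (x - 1) R\<close>, and \<open>y\<close> fixes the right-hand side because it
  fixes \<open>R\<close> and its action commutes with that of \<open>x\<close>.\<close>

lemma act_act_assoc:
  assumes [simp]: "x \<in> carrier Q" "y \<in> carrier Q"
  shows "act y (act y (assoc x x y)) \<otimes> assoc x x y = act y (assoc x x y) \<otimes> act y (assoc x x y)"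
proof -
  define P R where "P = assoc x x y" and "R = assoc x y y"
  have [simp]: "P \<in> nucleus_center" "R \<in> nucleus_center"
    by (simp_all add: P_def R_def)
  have yR: "act y R = R" by (simp add: R_def act_assoc_right)
  have bal: "act y P \<otimes> R = act x R \<otimes> P"
    unfolding P_def R_def by (rule act_assoc_balance) simp_all
  have "act y (act y P) \<otimes> R = act x R \<otimes> act y P"
    using arg_cong[OF bal, of "act y"] act_commute[of y x R] by (simp add: act_hom yR)
  then have "(act y (act y P) \<otimes> R) \<otimes> P = (act x R \<otimes> P) \<otimes> act y P"
    by (simp add: nucleus_center_ac)
  then have "(act y (act y P) \<otimes> P) \<otimes> R = (act y P \<otimes> act y P) \<otimes> R"
    by (simp add: nucleus_center_ac flip: bal)
  then show ?thesis by (simp add: r_cancel_iff P_def)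
qed

lemma assoc_cube_right:
  assumes [simp]: "x \<in> carrier Q" "y \<in> carrier Q" "z \<in> carrier Q"
  shows "assoc x y ((z \<otimes> z) \<otimes> z) = act z (act z (assoc x y z)) \<otimes> (act z (assoc x y z) \<otimes> assoc x y z)"
  by (simp add: assoc_mult_right act_hom nucleus_center_assoc)

text \<open>The sixth power is nested to the left, as \<open>[^]\<close> produces it. Splitting off
  the last three factors conjugates \<open>assoc x y z3\<close>, which is fixed, and contributes a
  second copy of it. Naming the cube \<open>z3\<close> stops the product rule from splitting it
  too.\<close>

lemma assoc_sixth_right:
  assumes [simp]: "x \<in> carrier Q" "y \<in> carrier Q" "z \<in> carrier Q"
    and z3: "z3 = (z \<otimes> z) \<otimes> z" and fixed: "act z (assoc x y z3) = assoc x y z3"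
  shows "assoc x y (((z3 \<otimes> z) \<otimes> z) \<otimes> z) = assoc x y z3 \<otimes> assoc x y z3"
proof -
  have [simp]: "z3 \<in> carrier Q" by (simp add: z3)
  have "assoc x y (((z3 \<otimes> z) \<otimes> z) \<otimes> z) =
      assoc x y z3 \<otimes> (act z (act z (assoc x y z)) \<otimes> (act z (assoc x y z) \<otimes> assoc x y z))"
    by (simp add: assoc_mult_right[of x y _ z] act_hom fixed nucleus_center_assoc)
  then show ?thesis by (simp add: z3 assoc_cube_right)
qed

text \<open>Additively, \<open>(y^2 + y + 1) P = 3 y P\<close> by \<open>act_act_assoc\<close>, and
  \<open>y\<close> fixes \<open>3 P\<close>.\<close>

lemma assoc_diag_cube:
  assumes [simp]: "x \<in> carrier Q" "y \<in> carrier Q"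
  shows "assoc x x ((y \<otimes> y) \<otimes> y) = cube (assoc x x y)"
proof -
  let ?P = "assoc x x y"
  have "assoc x x ((y \<otimes> y) \<otimes> y) = act y ?P \<otimes> (act y (act y ?P) \<otimes> ?P)"
    by (simp add: assoc_cube_right nucleus_center_ac)
  also have "\<dots> = cube (act y ?P)"
    by (simp add: act_act_assoc cube_def)
  also have "\<dots> = cube ?P"
    using act_cube_assoc_right[of x y] by (simp add: act_cube)
  finally show ?thesis .
qed

lemma assoc_right_cube:
  assumes [simp]: "x \<in> carrier Q" "y \<in> carrier Q"
  shows "assoc x y ((y \<otimes> y) \<otimes> y) = cube (assoc x x y)"
  using cube_assoc_symmetric[of x y] by (simp add: assoc_cube_right act_assoc_right cube_def)

section \<open>The two generated subloops\<close>

lemma group_generated_sixth: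
  assumes b [simp]: "b \<in> carrier Q" and c [simp]: "c \<in> carrier Q"
  shows "group (subloop_generated Q {b, c [^] (6::nat)})"
proof -
  define k where "k = (c \<otimes> c) \<otimes> c"
  define l where "l = ((k \<otimes> c) \<otimes> c) \<otimes> c"
  have [simp]: "k \<in> carrier Q" "l \<in> carrier Q" by (simp_all add: k_def l_def)
  have l: "c [^] (6::nat) = l"
    by (simp add: nat_pow_def numeral_eq_Suc k_def l_def)
  \<comment> \<open>Both \<open>assoc b b k\<close> and \<open>assoc b c k\<close> equal the cube of
    \<open>assoc b b c\<close>; it is fixed by \<open>c\<close>, and its square is
    \<open>\<one>\<close>.\<close>
  have bbl: "assoc b b l = \<one>"
    unfolding l_def using assoc_sixth_right[of b b c k] assoc_diag_cube[of b c]
    by (simp add: act_cube_assoc_right cube_assoc_squared flip: k_def)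
  have "assoc b c l = \<one>"
    unfolding l_def using assoc_sixth_right[of b c c k] assoc_right_cube[of b c]
    by (simp add: act_cube_assoc_right cube_assoc_squared flip: k_def)
  then have blc: "assoc b l c = \<one>"
    using assoc_swap_right[of c l b] by simp
  \<comment> \<open>Since \<open>assoc b l c\<close> is trivial, a further factor \<open>c\<close>
    only conjugates, so triviality climbs through the powers of \<open>c\<close> up to
    \<open>l\<close>.\<close>
  have mult_c: "assoc b l (z \<otimes> c) = act c (assoc b l z)" if "z \<in> carrier Q" for z
    using that by (simp add: assoc_mult_right[of b l z c] blc)
  have "assoc b l k = \<one>"
    using mult_c[of "c \<otimes> c"] mult_c[of c] by (simp add: blc flip: k_def)
  then have bll: "assoc b l l = \<one>"
    using mult_c[of "(k \<otimes> c) \<otimes> c"] mult_c[of "k \<otimes> c"] mult_c[of k]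
    by (simp flip: l_def)
  have "assoc x y z = \<one>" if "x \<in> {b, l}" "y \<in> {b, l}" "z \<in> {b, l}" for x y z
    using that bbl bll assoc_swap_right[of l b b] assoc_swap_left[of b l b]
      assoc_swap_left[of b l l] assoc_swap_right[of b l l] by auto
  then show ?thesis
    unfolding l by (intro group_subloop_generated) simp_all
qed

lemma group_generated_square_cube:
  assumes b [simp]: "b \<in> carrier Q" and c [simp]: "c \<in> carrier Q"
  shows "group (subloop_generated Q {b [^] (2::nat), c [^] (3::nat)})"
proof -
  define k where "k = (c \<otimes> c) \<otimes> c"
  define d where "d = b \<otimes> b"
  define p where "p = cube (assoc b b c)"
  have [simp]: "k \<in> carrier Q" "d \<in> carrier Q" "p \<in> nucleus_center"
    by (simp_all add: k_def d_def p_def)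
  have pow: "c [^] (3::nat) = k" "b [^] (2::nat) = d"
    by (simp_all add: nat_pow_def numeral_eq_Suc k_def d_def)
  have p: "act b p = p" "act c p = p" "p \<otimes> p = \<one>"
    by (simp_all add: p_def act_cube_assoc_left act_cube_assoc_right cube_assoc_squared)
  have d: "assoc x y d = act b (assoc x y b) \<otimes> assoc x y b"
    if "x \<in> carrier Q" "y \<in> carrier Q" for x y
    using that by (simp add: d_def assoc_mult_right)
  have "assoc b k b = p"
    using assoc_swap_right[of b k b] assoc_diag_cube[of b c] by (simp add: p_def k_def)
  \<comment> \<open>Squaring \<open>b\<close> doubles the fixed value \<open>p\<close>, and
    \<open>p \<otimes> p = \<one>\<close>.\<close>
  then have "assoc b k d = \<one>"
    by (simp add: d p)
  then have "assoc d k b = \<one>"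
    using assoc_swap_right[of k d b] assoc_swap_left[of d b k] assoc_swap_right[of b k d] by simp
  then have dkd: "assoc d k d = \<one>"
    by (simp add: d)
  have "assoc b k c = p"
    using assoc_swap_right[of c k b] assoc_right_cube[of b c] by (simp add: p_def k_def)
  \<comment> \<open>Cubing \<open>c\<close> triples the fixed value \<open>p\<close>, which leaves
    \<open>p\<close> because its square is \<open>\<one>\<close>; the square of \<open>b\<close>
    then kills it.\<close>
  then have "assoc b k k = p"
    using assoc_cube_right[of b k c] by (simp add: p flip: k_def)
  then have "assoc k k b = p"
    using assoc_swap_left[of b k k] assoc_swap_right[of b k k] by simp
  then have kkd: "assoc k k d = \<one>"
    by (simp add: d p)
  have "assoc x y z = \<one>" if "x \<in> {d, k}" "y \<in> {d, k}" "z \<in> {d, k}" for x y z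
    using that dkd kkd assoc_swap_right[of k d d] assoc_swap_left[of d k d]
      assoc_swap_left[of d k k] assoc_swap_right[of d k k] by auto
  then show ?thesis
    unfolding pow by (intro group_subloop_generated) simp_all
qed

end

theorem corollary7p5:
  fixes Q :: "('a, 'm) monoid_scheme" (structure)
  assumes "power_associative_loop Q" and "cc_loop Q"
    and "b \<in> carrier Q" and "c \<in> carrier Q"
  shows "group (subloop_generated Q {b, c [^] (6::nat)}) \<and>
    group (subloop_generated Q {b [^] (2::nat), c [^] (3::nat)})"
proof -
  interpret pacc_loop Q
    using assms(1,2) by (rule pacc_loop.intro)
  show ?thesis
    using assms(3,4) by (intro conjI group_generated_sixth group_generated_square_cube)
qed

end
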